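(* Let $p>0$, $R_i>0$, and let $\gamma_i,\eta_i$ lie between $0$ and $1$ for $i=1,2,3$. There exist lower bounds on the state feedback gains $k_1,k_2,k_3$ such that, when the gains are greater than their respective lower bounds, the triangularly coupled loop thermosyphon system with the single-state feedback $u_i=-k_iy_i$, $1\le i\le 3$, $$\begin{aligned} \dot x_1&=p\{(y_1-x_1)-\gamma_1(x_1-x_2)-\gamma_2(x_1-x_3)\},\\ \dot y_1&=R_1x_1-x_1z_1-k_1y_1,\\ \dot z_1&=x_1y_1-z_1-\eta_1(z_1-z_2)-\eta_2(z_1-z_3),\\ \dot x_2&=p\{(y_2-x_2)-\gamma_1(x_2-x_1)-\gamma_3(x_2-x_3)\},\\ \dot y_2&=R_2x_2-x_2z_2-k_2y_2,\\ \dot z_2&=x_2y_2-z_2-\eta_1(z_2-z_1)-\eta_3(z_2-z_3),\\ \dot x_3&=p\{(y_3-x_3)-\gamma_2(x_3-x_1)-\gamma_3(x_3-x_2)\},\\ \dot y_3&=R_3x_3-x_3z_3-k_3y_3,\\ \dot z_3&=x_3y_3-z_3-\eta_2(z_3-z_1)-\eta_3(z_3-z_2) \end{aligned}$$ is globally asymptotically stable at the origin.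
   Context: The state is $(x_1,y_1,z_1,x_2,y_2,z_2,x_3,y_3,z_3)\in\mathbb R^9$, where $x_i$ is the fluid velocity and $y_i,z_i$ are the horizontal and vertical temperature differences in loop $i$. The constants $R_i$ are Rayleigh numbers, $\gamma_i$ momentum coupling parameters, $\eta_i$ thermal coupling parameters, $p$ is a constant model parameter, and the $k_i$ are constant positive feedback gains. *)

theory Defs
  imports "HOL-Analysis.Analysis"
begin

text \<open>Solutions on \<open>[0,\<infinity>)\<close> of the autonomous equation \<open>\<phi>' = f \<phi>\<close>; the derivative at time \<open>0\<close>
  is one-sided.\<close>

definition forward_solution ::
  "('a::real_normed_vector \<Rightarrow> 'a) \<Rightarrow> 'a \<Rightarrow> (real \<Rightarrow> 'a) \<Rightarrow> bool" where
  "forward_solution f s0 \<phi> \<longleftrightarrow>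
     \<phi> 0 = s0 \<and> (\<forall>t\<ge>0. (\<phi> has_vector_derivative f (\<phi> t)) (at t within {0..}))"

definition forward_complete :: "('a::real_normed_vector \<Rightarrow> 'a) \<Rightarrow> bool" where
  "forward_complete f \<longleftrightarrow> (\<forall>s0. \<exists>\<phi>. forward_solution f s0 \<phi>)"

definition lyapunov_stable :: "('a::real_normed_vector \<Rightarrow> 'a) \<Rightarrow> 'a \<Rightarrow> bool" where
  "lyapunov_stable f e \<longleftrightarrow>
     (\<forall>\<epsilon>>0. \<exists>\<delta>>0. \<forall>s0 \<phi>. dist s0 e < \<delta> \<longrightarrow> forward_solution f s0 \<phi> \<longrightarrow>
        (\<forall>t\<ge>0. dist (\<phi> t) e < \<epsilon>))"

definition globally_attractive :: "('a::real_normed_vector \<Rightarrow> 'a) \<Rightarrow> 'a \<Rightarrow> bool" where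
  "globally_attractive f e \<longleftrightarrow> (\<forall>s0 \<phi>. forward_solution f s0 \<phi> \<longrightarrow> (\<phi> \<longlongrightarrow> e) at_top)"

text \<open>Stability and attractivity above only speak about solutions that exist for all \<open>t \<ge> 0\<close>.
  Forward completeness is therefore part of global asymptotic stability: finite-time blow-up is
  excluded, and neither of the other two conditions can hold vacuously.\<close>

definition globally_asymptotically_stable :: "('a::real_normed_vector \<Rightarrow> 'a) \<Rightarrow> 'a \<Rightarrow> bool" where
  "globally_asymptotically_stable f e \<longleftrightarrow>
     f e = 0 \<and> forward_complete f \<and> lyapunov_stable f e \<and> globally_attractive f e"

text \<open>\<open>\<real>\<^sup>9\<close> as a nine-fold product, which carries the Euclidean norm; the components are
  \<open>(x\<^sub>1, y\<^sub>1, z\<^sub>1, x\<^sub>2, y\<^sub>2, z\<^sub>2, x\<^sub>3, y\<^sub>3, z\<^sub>3)\<close>.\<close>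

type_synonym state =
  "real \<times> real \<times> real \<times> real \<times> real \<times> real \<times> real \<times> real \<times> real"

text \<open>The closed loop of the triangularly coupled thermosyphons, with the feedback
  \<open>u\<^sub>i = - k\<^sub>i y\<^sub>i\<close> already substituted in the \<open>y\<^sub>i\<close> equations.\<close>

definition thermosyphon_field ::
  "real \<Rightarrow> real \<Rightarrow> real \<Rightarrow> real \<Rightarrow> real \<Rightarrow> real \<Rightarrow> real \<Rightarrow> real \<Rightarrow> real \<Rightarrow> real \<Rightarrow>
   real \<Rightarrow> real \<Rightarrow> real \<Rightarrow> state \<Rightarrow> state" where
  "thermosyphon_field p R1 R2 R3 \<gamma>1 \<gamma>2 \<gamma>3 \<eta>1 \<eta>2 \<eta>3 k1 k2 k3 =
     (\<lambda>(x1, y1, z1, x2, y2, z2, x3, y3, z3).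
       (p * ((y1 - x1) - \<gamma>1 * (x1 - x2) - \<gamma>2 * (x1 - x3)),
        R1 * x1 - x1 * z1 - k1 * y1,
        x1 * y1 - z1 - \<eta>1 * (z1 - z2) - \<eta>2 * (z1 - z3),
        p * ((y2 - x2) - \<gamma>1 * (x2 - x1) - \<gamma>3 * (x2 - x3)),
        R2 * x2 - x2 * z2 - k2 * y2,
        x2 * y2 - z2 - \<eta>1 * (z2 - z1) - \<eta>3 * (z2 - z3),
        p * ((y3 - x3) - \<gamma>2 * (x3 - x1) - \<gamma>3 * (x3 - x2)),
        R3 * x3 - x3 * z3 - k3 * y3,
        x3 * y3 - z3 - \<eta>2 * (z3 - z1) - \<eta>3 * (z3 - z2)))"

end

theory Submission
  imports Defs
begin

text \<open>The quadratic form \<open>V = \<Sum>\<^sub>i (x\<^sub>i\<^sup>2/p + y\<^sub>i\<^sup>2 + z\<^sub>i\<^sup>2)\<close> is a strict Lyapunov function: the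
  cubic terms \<open>-x\<^sub>iy\<^sub>iz\<^sub>i\<close> and \<open>x\<^sub>iy\<^sub>iz\<^sub>i\<close> cancel, the coupling terms are dissipative, and the
  remaining indefinite terms \<open>(1 + R\<^sub>i)x\<^sub>iy\<^sub>i\<close> are dominated by \<open>x\<^sub>i\<^sup>2 + k\<^sub>iy\<^sub>i\<^sup>2\<close> as soon as
  \<open>k\<^sub>i > (1 + R\<^sub>i)\<^sup>2\<close>. Hence \<open>V\<close> decays exponentially along every solution. For forward completeness,
  compose the field with the nearest-point projection onto a large ball. The result is globally
  Lipschitz, so it has global solutions; as the gradient of \<open>V\<close> is linear and the projection is
  radial, \<open>V\<close> still does not increase along them, so they stay in the ball, where the two fields agree.\<close>

subsection \<open>Global solutions of Lipschitz equations\<close>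

text \<open>Integrating \<open>exp (a * s)\<close> gains a factor \<open>1 / a\<close>. This gain
  bounds the rescaled Picard operator below and makes it contract.\<close>

lemma norm_integral_le_exp:
  fixes h :: "real \<Rightarrow> 'a::banach"
  assumes "continuous_on {0..t} h" "0 \<le> t" "a > 0"
    and bound: "\<And>s. s \<in> {0..t} \<Longrightarrow> norm (h s) \<le> K * exp (a * s)"
  shows "norm (integral {0..t} h) \<le> K / a * (exp (a * t) - 1)"
proof -
  have "((\<lambda>s. K * exp (a * s)) has_integral K / a * exp (a * t) - K / a * exp (a * 0)) {0..t}"
    using assms(2,3)
    by (intro fundamental_theorem_of_calculus)
      (auto simp flip: has_real_derivative_iff_has_vector_derivative intro!: derivative_eq_intros)
  moreover have "h integrable_on {0..t}"
    by (rule integrable_continuous_real) fact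
  ultimately have "norm (integral {0..t} h) \<le> K / a * exp (a * t) - K / a * exp (a * 0)"
    by (metis bound has_integral_integrable integral_norm_bound_integral integral_unique)
  then show ?thesis
    by (simp add: algebra_simps)
qed

text \<open>The Picard operator is a contraction on all of \<open>[0,\<infinity>)\<close> at once when the unknown
  \<open>\<phi>\<close> is rescaled to \<open>\<psi> t = exp (- 2Lt) \<phi> t\<close>; constant extension to negative times makes
  \<open>\<psi>\<close> an element of the complete space of bounded continuous functions.\<close>

lemma lipschitz_forward_complete:
  fixes g :: "'a::banach \<Rightarrow> 'a"
  assumes "L-lipschitz_on UNIV g"
  shows "forward_complete g"
  unfolding forward_complete_def
proof
  fix s0 :: 'a
  \<comment> \<open>The factor 2 leads to contraction constant 1/2; the added 1 keeps
    \<open>a\<close> positive when \<open>L = 0\<close>.\<close>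
  define a where "a = 2 * (L + 1)"
  have L: "L \<ge> 0" and a: "a > 0"
    using lipschitz_on_nonneg[OF assms] by (auto simp: a_def)
  have lip: "dist (g u) (g v) \<le> a / 2 * dist u v" for u v
  proof -
    have "dist (g u) (g v) \<le> L * dist u v"
      using lipschitz_onD[OF assms] by simp
    also have "\<dots> \<le> a / 2 * dist u v"
      by (intro mult_right_mono) (auto simp: a_def)
    finally show ?thesis .
  qed
  have cont_g: "continuous_on S g" for S
    using lipschitz_on_continuous_on[OF assms] continuous_on_subset by blast
  \<comment> \<open>\<open>h \<psi>\<close> is the right-hand side along the unscaled candidate
    \<open>exp (a * s) *\<^sub>R \<psi> s\<close>, and \<open>T\<close> is the Picard operator
    scaled back. Through \<open>max 0 t\<close>, \<open>T \<psi>\<close> is constantly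
    \<open>s0\<close> at negative times.\<close>
  define h where "h \<psi> s = g (exp (a * s) *\<^sub>R apply_bcontfun \<psi> s)" for \<psi> s
  define T where "T \<psi> t = exp (- a * max 0 t) *\<^sub>R (s0 + integral {0..max 0 t} (h \<psi>))" for \<psi> t
  have cont_h: "continuous_on S (h \<psi>)" for S \<psi>
    unfolding h_def by (intro continuous_on_compose2[OF cont_g[of UNIV]] continuous_intros) auto
  have deriv: "((\<lambda>u. integral {0..u} (h \<psi>)) has_vector_derivative h \<psi> t) (at t within {0..})"
    if "t \<ge> 0" for \<psi> t
  proof -
    have "((\<lambda>u. integral {0..u} (h \<psi>)) has_vector_derivative h \<psi> t) (at t within {0..t+1})"
      using that by (intro integral_has_vector_derivative cont_h) auto
    moreover have "at t within {0..t+1} = at t within {0..}"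
      by (rule at_within_nhd[of _ "{t-1<..<t+1}"]) auto
    ultimately show ?thesis
      by simp
  qed
  have T_bcontfun: "T \<psi> \<in> bcontfun" for \<psi>
  proof -
    have "continuous_on {0..} (\<lambda>u. integral {0..u} (h \<psi>))"
      unfolding continuous_on_eq_continuous_within
      by (blast intro: has_vector_derivative_continuous deriv atLeast_iff[THEN iffD1])
    then have "continuous_on UNIV (T \<psi>)"
      unfolding T_def by (intro continuous_intros continuous_on_compose2[of "{0..}" _ UNIV]) auto
    moreover obtain M where M: "\<And>t. norm (apply_bcontfun \<psi> t) \<le> M"
      using bounded_apply_bcontfun[of \<psi>] by (auto simp: bounded_iff)
    define K where "K = norm (g 0) + a / 2 * M"
    have "M \<ge> 0"
      using M[of 0] norm_ge_zero order_trans by blast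
    then have "K \<ge> 0"
      using a by (auto simp: K_def)
    \<comment> \<open>Comparison with \<open>g 0\<close> gives \<open>g\<close> at most linear
      growth, so \<open>h \<psi>\<close> grows no faster than the weight that \<open>T\<close>
      divides out.\<close>
    have h_bound: "norm (h \<psi> s) \<le> K * exp (a * s)" if "s \<ge> 0" for s
    proof -
      have "norm (h \<psi> s) \<le> norm (g 0) + dist (h \<psi> s) (g 0)"
        by (metis add.commute dist_norm norm_triangle_sub)
      also have "dist (h \<psi> s) (g 0) \<le> a / 2 * (exp (a * s) * norm (apply_bcontfun \<psi> s))"
        using lip[of "exp (a * s) *\<^sub>R apply_bcontfun \<psi> s" 0] by (simp add: h_def)
      also have "\<dots> \<le> a / 2 * (exp (a * s) * M)"
        using a M by (intro mult_left_mono) auto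
      also have "norm (g 0) \<le> norm (g 0) * exp (a * s)"
        using a that by (simp add: mult_le_cancel_left1)
      finally show ?thesis
        by (simp add: K_def algebra_simps)
    qed
    have "norm (T \<psi> t) \<le> norm s0 + K / a" for t
    proof -
      define \<tau> where "\<tau> = max 0 t"
      have "\<tau> \<ge> 0" by (simp add: \<tau>_def)
      have "norm (T \<psi> t) = exp (- a * \<tau>) * norm (s0 + integral {0..\<tau>} (h \<psi>))"
        by (simp add: T_def \<tau>_def)
      also have "\<dots> \<le> exp (- a * \<tau>) * (norm s0 + K / a * (exp (a * \<tau>) - 1))"
        using \<open>\<tau> \<ge> 0\<close> a h_bound
        by (intro mult_left_mono norm_triangle_mono norm_integral_le_exp cont_h) auto
      also have "\<dots> \<le> exp (- a * \<tau>) * (exp (a * \<tau>) * (norm s0 + K / a))"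
      proof (intro mult_left_mono)
        have "norm s0 * 1 \<le> norm s0 * exp (a * \<tau>)"
          using \<open>\<tau> \<ge> 0\<close> a by (intro mult_left_mono) auto
        moreover have "K / a \<ge> 0"
          using \<open>K \<ge> 0\<close> a by simp
        ultimately show "norm s0 + K / a * (exp (a * \<tau>) - 1) \<le> exp (a * \<tau>) * (norm s0 + K / a)"
          by (simp add: algebra_simps)
      qed auto
      also have "\<dots> = norm s0 + K / a"
        by (simp add: exp_minus)
      finally show ?thesis .
    qed
    then have "bounded (range (T \<psi>))"
      by (auto simp: bounded_iff)
    ultimately show ?thesis
      by (simp add: bcontfun_def)
  qed
  have "dist (T \<psi>1 t) (T \<psi>2 t) \<le> 1 / 2 * dist \<psi>1 \<psi>2" for \<psi>1 \<psi>2 t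
  proof -
    define \<tau> where "\<tau> = max 0 t"
    define d where "d = dist \<psi>1 \<psi>2"
    have "\<tau> \<ge> 0" by (simp add: \<tau>_def)
    \<comment> \<open>The Lipschitz constant \<open>a / 2\<close> times the gain
      \<open>1 / a\<close> from integration is the contraction constant 1/2.\<close>
    have "norm (h \<psi>1 s - h \<psi>2 s) \<le> (a / 2 * d) * exp (a * s)" for s
    proof -
      have "norm (h \<psi>1 s - h \<psi>2 s)
          \<le> a / 2 * dist (exp (a * s) *\<^sub>R apply_bcontfun \<psi>1 s) (exp (a * s) *\<^sub>R apply_bcontfun \<psi>2 s)"
        using lip by (simp add: h_def flip: dist_norm)
      also have "\<dots> = a / 2 * (exp (a * s) * dist (apply_bcontfun \<psi>1 s) (apply_bcontfun \<psi>2 s))"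
        by (simp add: dist_norm flip: scaleR_diff_right)
      also have "\<dots> \<le> a / 2 * (exp (a * s) * d)"
        using a dist_bounded by (intro mult_left_mono) (auto simp: d_def)
      finally show ?thesis
        by (simp add: mult_ac)
    qed
    then have "norm (integral {0..\<tau>} (\<lambda>s. h \<psi>1 s - h \<psi>2 s)) \<le> (a / 2 * d) / a * (exp (a * \<tau>) - 1)"
      using \<open>\<tau> \<ge> 0\<close> a by (intro norm_integral_le_exp continuous_intros cont_h) auto
    also have "\<dots> \<le> d / 2 * exp (a * \<tau>)"
      using a by (simp add: d_def field_simps)
    finally have *: "norm (integral {0..\<tau>} (\<lambda>s. h \<psi>1 s - h \<psi>2 s)) \<le> d / 2 * exp (a * \<tau>)" .
    have "integral {0..\<tau>} (\<lambda>s. h \<psi>1 s - h \<psi>2 s) = integral {0..\<tau>} (h \<psi>1) - integral {0..\<tau>} (h \<psi>2)"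
      by (intro integral_diff integrable_continuous_real cont_h)
    then have "T \<psi>1 t - T \<psi>2 t = exp (- a * \<tau>) *\<^sub>R integral {0..\<tau>} (\<lambda>s. h \<psi>1 s - h \<psi>2 s)"
      by (simp add: T_def \<tau>_def flip: scaleR_diff_right)
    then have "dist (T \<psi>1 t) (T \<psi>2 t) = exp (- a * \<tau>) * norm (integral {0..\<tau>} (\<lambda>s. h \<psi>1 s - h \<psi>2 s))"
      by (simp add: dist_norm)
    also have "\<dots> \<le> exp (- a * \<tau>) * (d / 2 * exp (a * \<tau>))"
      by (intro mult_left_mono *) auto
    also have "\<dots> = 1 / 2 * dist \<psi>1 \<psi>2"
      by (simp add: exp_minus d_def)
    finally show ?thesis .
  qed
  then have "dist (Bcontfun (T \<psi>1)) (Bcontfun (T \<psi>2)) \<le> 1 / 2 * dist \<psi>1 \<psi>2" for \<psi>1 \<psi>2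
    by (intro dist_bound) (simp only: Bcontfun_inverse T_bcontfun)
  then have "\<exists>!\<psi>. Bcontfun (T \<psi>) = \<psi>"
    by (intro banach_fix_type[where c = "1 / 2"]) auto
  then obtain \<psi> where "Bcontfun (T \<psi>) = \<psi>"
    by blast
  then have fixpoint: "apply_bcontfun \<psi> t = T \<psi> t" for t
    by (metis Bcontfun_inverse T_bcontfun)
  \<comment> \<open>Undoing the scaling: the fixed-point equation says
    \<open>\<phi> t = exp (a * t) *\<^sub>R \<psi> t\<close> for t \<ge> 0, so \<open>\<phi>\<close>
    is the integral of its own right-hand side.\<close>
  define \<phi> where "\<phi> t = s0 + integral {0..t} (h \<psi>)" for t
  have "h \<psi> t = g (\<phi> t)" if "t \<ge> 0" for t
    using that by (simp add: h_def fixpoint[of t] T_def \<phi>_def flip: exp_add)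
  then have "forward_solution g s0 \<phi>"
    unfolding forward_solution_def \<phi>_def
    by (auto intro!: derivative_eq_intros deriv)
  then show "\<exists>\<phi>. forward_solution g s0 \<phi>"
    by blast
qed

subsection \<open>Quadratic Lyapunov functions\<close>

text \<open>By symmetry of \<open>A\<close>, the form has derivative
  \<open>2 * (A \<phi> \<bullet> g \<phi>)\<close> along a solution, so multiplying it by
  \<open>exp (2 * c * t)\<close> gives a nonincreasing function. It serves with \<open>c = 0\<close>
  for the truncated field and with \<open>c > 0\<close> for the field itself.\<close>

lemma quadratic_form_decay:
  fixes A g :: "'a::real_inner \<Rightarrow> 'a"
  assumes A: "bounded_linear A" and sym: "\<And>u v. A u \<bullet> v = u \<bullet> A v"
    and dissipative: "\<And>s. A s \<bullet> g s \<le> - c * (A s \<bullet> s)"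
    and sol: "forward_solution g s0 \<phi>" and "t \<ge> 0"
  shows "A (\<phi> t) \<bullet> \<phi> t \<le> exp (- 2 * c * t) * (A s0 \<bullet> s0)"
proof -
  define W where "W t = exp (2 * c * t) * (A (\<phi> t) \<bullet> \<phi> t)" for t
  have deriv: "(W has_real_derivative
      exp (2 * c * s) * (2 * (A (\<phi> s) \<bullet> g (\<phi> s)) + 2 * c * (A (\<phi> s) \<bullet> \<phi> s)))
      (at s within {0..})" if "s \<ge> 0" for s
  proof -
    have \<phi>: "(\<phi> has_vector_derivative g (\<phi> s)) (at s within {0..})"
      using sol that by (auto simp: forward_solution_def)
    have "((\<lambda>t. A (\<phi> t) \<bullet> \<phi> t) has_vector_derivative
        A (\<phi> s) \<bullet> g (\<phi> s) + A (g (\<phi> s)) \<bullet> \<phi> s) (at s within {0..})"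
      by (intro bounded_bilinear.has_vector_derivative[OF bounded_bilinear_inner]
          bounded_linear.has_vector_derivative[OF A] \<phi>)
    then have "((\<lambda>t. A (\<phi> t) \<bullet> \<phi> t) has_real_derivative 2 * (A (\<phi> s) \<bullet> g (\<phi> s)))
        (at s within {0..})"
      by (simp add: has_real_derivative_iff_has_vector_derivative sym inner_commute)
    then show ?thesis
      unfolding W_def by (auto intro!: derivative_eq_intros simp: algebra_simps)
  qed
  \<comment> \<open>At time 0 the derivative is one-sided, so monotonicity is drawn from derivatives
    on the open interval and continuity up to 0.\<close>
  have "W t \<le> W 0"
  proof (rule DERIV_nonpos_imp_decreasing_open[OF \<open>t \<ge> 0\<close>])
    have "continuous_on {0..} W"
      by (meson DERIV_continuous atLeast_iff continuous_on_eq_continuous_within deriv)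
    then show "continuous_on {0..t} W"
      by (rule continuous_on_subset) auto
  next
    fix s assume "0 < s" "s < t"
    then have "at s within {0..} = at s"
      by (intro at_within_interior) auto
    with deriv[of s] \<open>0 < s\<close> dissipative[of "\<phi> s"]
    show "\<exists>y. (W has_real_derivative y) (at s) \<and> y \<le> 0"
      by (intro exI conjI) (auto intro!: mult_nonneg_nonpos)
  qed
  then have "exp (- 2 * c * t) * W t \<le> exp (- 2 * c * t) * W 0"
    by (intro mult_left_mono) auto
  moreover have "exp (- 2 * c * t) * W t = A (\<phi> t) \<bullet> \<phi> t"
    by (simp add: W_def flip: exp_add mult.assoc)
  moreover have "W 0 = A s0 \<bullet> s0"
    using sol by (simp add: W_def forward_solution_def)
  ultimately show ?thesis
    by metis
qed

text \<open>The radial point lies at distance \<open>norm s - r\<close> from \<open>s\<close>, and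
  by the triangle inequality no point of the ball is closer. Convexity makes the minimiser
  unique.\<close>

lemma closest_point_cball_0:
  fixes s :: "'a::euclidean_space"
  assumes "r > 0" "norm s \<ge> r"
  shows "closest_point (cball 0 r) s = (r / norm s) *\<^sub>R s"
proof (rule closest_point_unique[symmetric])
  have "s - (r / norm s) *\<^sub>R s = ((norm s - r) / norm s) *\<^sub>R s"
    using assms by (simp add: diff_divide_distrib scaleR_diff_left)
  then have "dist s ((r / norm s) *\<^sub>R s) = norm s - r"
    using assms by (auto simp: dist_norm)
  moreover have "norm s \<le> dist s z + norm z" for z
    by (metis dist_0_norm dist_commute dist_triangle)
  ultimately show "\<forall>z\<in>cball 0 r. dist s ((r / norm s) *\<^sub>R s) \<le> dist s z"
    by (smt (verit) mem_cball_0)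
qed (use assms in auto)

text \<open>Lipschitz bounds on balls suffice because the form confines each solution to a ball.
  Coercivity and boundedness of \<open>A\<close> make the form comparable to the squared norm, so
  its decay becomes exponential decay of the state.\<close>

theorem quadratic_lyapunov_imp_globally_asymptotically_stable:
  fixes A f :: "'a::euclidean_space \<Rightarrow> 'a"
  assumes A: "bounded_linear A" and sym: "\<And>u v. A u \<bullet> v = u \<bullet> A v"
    and "a > 0" and coercive: "\<And>s. a * (norm s)\<^sup>2 \<le> A s \<bullet> s"
    and "c > 0" and dissipative: "\<And>s. A s \<bullet> f s \<le> - c * (A s \<bullet> s)"
    and lip: "\<And>r. \<exists>L. L-lipschitz_on (cball 0 r) f"
    and "f 0 = 0"
  shows "globally_asymptotically_stable f 0"
proof -
  have nonneg: "A s \<bullet> s \<ge> 0" for s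
    using coercive[of s] \<open>a > 0\<close> by (meson order_trans mult_nonneg_nonneg less_imp_le zero_le_power2)
  have "forward_complete f"
    unfolding forward_complete_def
  proof
    fix s0 :: 'a
    \<comment> \<open>By coercivity the ball of radius \<open>r\<close> contains the sublevel set of
      the form through \<open>s0\<close>; the added 1 makes \<open>r\<close> positive even for
      \<open>s0 = 0\<close>.\<close>
    define r where "r = sqrt ((A s0 \<bullet> s0) / a) + 1"
    have "r > 0"
      using nonneg[of s0] \<open>a > 0\<close> by (auto simp: r_def intro!: add_nonneg_pos)
    define P where "P = closest_point (cball (0::'a) r)"
    have P_mem: "P s \<in> cball 0 r" for s
      unfolding P_def using \<open>r > 0\<close> by (intro closest_point_in_set) auto
    have P_id: "P s = s" if "norm s \<le> r" for s
      unfolding P_def using that by (intro closest_point_self) auto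
    obtain L where L: "L-lipschitz_on (cball 0 r) f"
      using lip by blast
    have "1-lipschitz_on UNIV P"
      unfolding P_def using \<open>r > 0\<close> by (intro lipschitz_onI) (auto intro!: closest_point_lipschitz)
    moreover have "L-lipschitz_on (range P) f"
      by (rule lipschitz_on_subset[OF L]) (use P_mem in blast)
    ultimately have "(L * 1)-lipschitz_on UNIV (\<lambda>s. f (P s))"
      by (rule lipschitz_on_compose2)
    then obtain \<phi> where \<phi>: "forward_solution (\<lambda>s. f (P s)) s0 \<phi>"
      using lipschitz_forward_complete forward_complete_def by metis
    \<comment> \<open>Only the sign survives truncation: for \<open>s = \<mu> *\<^sub>R P s\<close>
      the left side scales with \<mu> but the form with its square, so the rate degrades far
      out.\<close>
    have "A s \<bullet> f (P s) \<le> - 0 * (A s \<bullet> s)" for s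
    proof -
      have "\<exists>\<mu>\<ge>0. s = \<mu> *\<^sub>R P s"
      proof (cases "norm s \<le> r")
        case True
        then show ?thesis
          by (intro exI[of _ 1]) (simp add: P_id)
      next
        case False
        then show ?thesis
          using \<open>r > 0\<close> by (intro exI[of _ "norm s / r"]) (auto simp: P_def closest_point_cball_0)
      qed
      then obtain \<mu> where \<mu>: "\<mu> \<ge> 0" "s = \<mu> *\<^sub>R P s"
        by blast
      have "A s = \<mu> *\<^sub>R A (P s)"
        by (metis \<mu>(2) A linear_simps(5))
      moreover have "A (P s) \<bullet> f (P s) \<le> 0"
        using dissipative[of "P s"] nonneg[of "P s"] \<open>c > 0\<close>
        by (smt (verit) mult_minus_left mult_nonneg_nonneg)
      ultimately show ?thesis
        using \<mu>(1) by (simp add: mult_nonneg_nonpos)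
    qed
    from quadratic_form_decay[OF A sym this \<phi>]
    have decr: "A (\<phi> t) \<bullet> \<phi> t \<le> A s0 \<bullet> s0" if "t \<ge> 0" for t
      using that by simp
    have "norm (\<phi> t) \<le> r" if "t \<ge> 0" for t
    proof -
      have "(norm (\<phi> t))\<^sup>2 \<le> (A s0 \<bullet> s0) / a"
        using coercive[of "\<phi> t"] decr[OF that] \<open>a > 0\<close> by (simp add: field_simps)
      then have "norm (\<phi> t) \<le> sqrt ((A s0 \<bullet> s0) / a)"
        by (rule real_le_rsqrt)
      then show ?thesis
        by (simp add: r_def)
    qed
    then have "forward_solution f s0 \<phi>"
      using \<phi> by (simp add: forward_solution_def P_id)
    then show "\<exists>\<phi>. forward_solution f s0 \<phi>"
      by blast
  qed
  moreover
  obtain B where B: "B > 0" "\<And>s. norm (A s) \<le> norm s * B"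
    using bounded_linear.pos_bounded[OF A] by blast
  \<comment> \<open>The form lies between \<open>a\<close> and \<open>B\<close> times the squared
    norm; \<open>C\<close> is the resulting overshoot factor.\<close>
  define C where "C = sqrt (B / a)"
  have "C > 0"
    using B \<open>a > 0\<close> by (simp add: C_def)
  have decay: "norm (\<phi> t) \<le> C * norm s0 * exp (- c * t)"
    if "forward_solution f s0 \<phi>" "t \<ge> 0" for s0 \<phi> t
  proof -
    have "a * (norm (\<phi> t))\<^sup>2 \<le> exp (- 2 * c * t) * (A s0 \<bullet> s0)"
      using coercive quadratic_form_decay[OF A sym dissipative that] by (rule order_trans)
    also have "A s0 \<bullet> s0 \<le> norm (A s0) * norm s0"
      by (rule norm_cauchy_schwarz)
    also have "\<dots> \<le> norm s0 * B * norm s0"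
      using B by (intro mult_right_mono) auto
    finally have "(norm (\<phi> t))\<^sup>2 \<le> B / a * (norm s0)\<^sup>2 * exp (- 2 * c * t)"
      using \<open>a > 0\<close> by (simp add: field_simps power2_eq_square)
    also have "\<dots> = (C * norm s0 * exp (- c * t))\<^sup>2"
      using B \<open>a > 0\<close> by (simp add: C_def power_mult_distrib flip: exp_double)
    finally show ?thesis
      using \<open>C > 0\<close> by (simp add: power2_le_iff_abs_le)
  qed
  have "lyapunov_stable f 0"
    unfolding lyapunov_stable_def
  proof (intro allI impI)
    fix \<epsilon> :: real assume "\<epsilon> > 0"
    show "\<exists>\<delta>>0. \<forall>s0 \<phi>. dist s0 0 < \<delta> \<longrightarrow> forward_solution f s0 \<phi> \<longrightarrow> (\<forall>t\<ge>0. dist (\<phi> t) 0 < \<epsilon>)"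
    proof (intro exI[of _ "\<epsilon> / C"] conjI allI impI)
      fix s0 :: 'a and \<phi> :: "real \<Rightarrow> 'a" and t :: real
      assume *: "dist s0 0 < \<epsilon> / C" "forward_solution f s0 \<phi>" "t \<ge> 0"
      have "norm (\<phi> t) \<le> C * norm s0 * exp (- c * t)"
        using * by (intro decay)
      also have "\<dots> \<le> C * norm s0 * 1"
        using \<open>C > 0\<close> \<open>c > 0\<close> \<open>t \<ge> 0\<close> by (intro mult_left_mono) auto
      also have "\<dots> < \<epsilon>"
        using * \<open>C > 0\<close> by (simp add: field_simps)
      finally show "dist (\<phi> t) 0 < \<epsilon>"
        by simp
    qed (use \<open>\<epsilon> > 0\<close> \<open>C > 0\<close> in auto)
  qed
  moreover have "globally_attractive f 0"
    unfolding globally_attractive_def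
  proof (intro allI impI)
    fix s0 :: 'a and \<phi> :: "real \<Rightarrow> 'a"
    assume "forward_solution f s0 \<phi>"
    then have "\<forall>\<^sub>F t in at_top. norm (\<phi> t) \<le> C * norm s0 * exp (- c * t)"
      by (intro eventually_mono[OF eventually_ge_at_top[of 0]] decay)
    moreover have "((\<lambda>t. C * norm s0 * exp (- c * t)) \<longlongrightarrow> C * norm s0 * 0) at_top"
      using \<open>c > 0\<close>
      by (intro tendsto_intros filterlim_compose[OF exp_at_bot]
          filterlim_tendsto_neg_mult_at_bot[OF tendsto_const] filterlim_ident) auto
    ultimately show "(\<phi> \<longlongrightarrow> 0) at_top"
      using Lim_null_comparison by fastforce
  qed
  ultimately show ?thesis
    using \<open>f 0 = 0\<close> by (simp add: globally_asymptotically_stable_def)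
qed

subsection \<open>The thermosyphon field\<close>

text \<open>Lipschitz functions are bounded on bounded sets, so both parts of the split
  \<open>f x * (g x - g y) + (f x - f y) * g y\<close> are controlled. Leaving the constants
  existential lets such rules be chained.\<close>

lemma lipschitz_on_mult_bounded:
  fixes f g :: "'a::heine_borel \<Rightarrow> real"
  assumes "bounded U" "\<exists>L. L-lipschitz_on U f" "\<exists>L. L-lipschitz_on U g"
  shows "\<exists>L. L-lipschitz_on U (\<lambda>x. f x * g x)"
proof -
  obtain L M where L: "L-lipschitz_on U f" and M: "M-lipschitz_on U g"
    using assms by blast
  have "bounded (f ` U)" "bounded (g ` U)"
    by (rule bounded_uniformly_continuous_image[OF lipschitz_on_uniformly_continuous \<open>bounded U\<close>],
        fact)+
  then obtain F G where F: "\<And>x. x \<in> U \<Longrightarrow> \<bar>f x\<bar> \<le> F" and G: "\<And>x. x \<in> U \<Longrightarrow> \<bar>g x\<bar> \<le> G"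
    by (auto simp: bounded_iff)
  show ?thesis
  proof (intro exI lipschitz_onI)
    fix x y assume xy: "x \<in> U" "y \<in> U"
    have "\<bar>f x * g x - f y * g y\<bar> = \<bar>f x * (g x - g y) + (f x - f y) * g y\<bar>"
      by (simp add: algebra_simps)
    also have "\<dots> \<le> \<bar>f x\<bar> * \<bar>g x - g y\<bar> + \<bar>f x - f y\<bar> * \<bar>g y\<bar>"
      by (metis abs_mult abs_triangle_ineq)
    \<comment> \<open>The absolute values keep the Lipschitz constant nonnegative even for empty
      \<open>U\<close>.\<close>
    also have "\<dots> \<le> \<bar>F\<bar> * (M * dist x y) + (L * dist x y) * \<bar>G\<bar>"
      using lipschitz_onD[OF L xy] lipschitz_onD[OF M xy] F[OF xy(1)] G[OF xy(2)]
      by (intro add_mono mult_mono) (auto simp: dist_real_def)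
    finally show "dist (f x * g x) (f y * g y) \<le> (\<bar>F\<bar> * M + L * \<bar>G\<bar>) * dist x y"
      by (simp add: dist_real_def algebra_simps)
  qed (use lipschitz_on_nonneg[OF L] lipschitz_on_nonneg[OF M] in auto)
qed

lemma thermosyphon_field_lipschitz:
  "\<exists>L. L-lipschitz_on (cball 0 r)
    (thermosyphon_field p R1 R2 R3 \<gamma>1 \<gamma>2 \<gamma>3 \<eta>1 \<eta>2 \<eta>3 k1 k2 k3)"
proof -
  \<comment> \<open>These closure rules follow the syntax of the field, whose components are built
    from projections, constants, differences and products.\<close>
  have id: "\<exists>L. L-lipschitz_on U (\<lambda>x. x)" for U :: "'a::metric_space set"
    using lipschitz_on_id by blast
  have const: "\<exists>L. L-lipschitz_on U (\<lambda>x. c)" for U :: "'a::metric_space set" and c :: real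
    using lipschitz_on_constant by blast
  have fst: "\<exists>L. L-lipschitz_on U (\<lambda>x. fst (g x))" if "\<exists>L. L-lipschitz_on U g"
    for U :: "'a::metric_space set" and g :: "'a \<Rightarrow> 'b::metric_space \<times> 'c::metric_space"
    using that by (force simp: lipschitz_on_def intro: order_trans[OF dist_fst_le])
  have snd: "\<exists>L. L-lipschitz_on U (\<lambda>x. snd (g x))" if "\<exists>L. L-lipschitz_on U g"
    for U :: "'a::metric_space set" and g :: "'a \<Rightarrow> 'b::metric_space \<times> 'c::metric_space"
    using that by (force simp: lipschitz_on_def intro: order_trans[OF dist_snd_le])
  have Pair: "\<exists>L. L-lipschitz_on U (\<lambda>x. (f x, g x))"
    if "\<exists>L. L-lipschitz_on U f" "\<exists>L. L-lipschitz_on U g"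
    for U :: "'a::metric_space set" and f :: "'a \<Rightarrow> 'b::metric_space" and g :: "'a \<Rightarrow> 'c::metric_space"
    using that lipschitz_on_Pair by blast
  have diff: "\<exists>L. L-lipschitz_on U (\<lambda>x. f x - g x)"
    if "\<exists>L. L-lipschitz_on U f" "\<exists>L. L-lipschitz_on U g"
    for U :: "'a::metric_space set" and f g :: "'a \<Rightarrow> real"
    using that lipschitz_on_diff by blast
  show ?thesis
    unfolding thermosyphon_field_def case_prod_beta
    by (intro Pair diff lipschitz_on_mult_bounded fst snd id const bounded_cball)
qed

text \<open>This bounds one uncoupled loop's share of half the derivative of the Lyapunov function.
  Completing the square in \<open>x - (1 + R) * y\<close> spends half of \<open>x\<^sup>2\<close>
  and half of \<open>k * y\<^sup>2\<close>; the other halves give the rates \<open>p / 2\<close> and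
  \<open>k / 2\<close>.\<close>

lemma loop_dissipation:
  fixes x y z R k p c :: real
  assumes "0 \<le> R" "(1 + R)\<^sup>2 < k" "c \<le> p / 2" "c \<le> k / 2" "c \<le> 1" "p > 0"
  shows "(1 + R) * x * y - x\<^sup>2 - k * y\<^sup>2 - z\<^sup>2 \<le> - c * (x\<^sup>2 / p + y\<^sup>2 + z\<^sup>2)"
proof -
  have "(1 + R)\<^sup>2 * y\<^sup>2 \<le> k * y\<^sup>2"
    using assms by (intro mult_right_mono) auto
  moreover have "0 \<le> (x - (1 + R) * y)\<^sup>2"
    by simp
  ultimately have "(1 + R) * x * y \<le> x\<^sup>2 / 2 + k * y\<^sup>2 / 2"
    by (simp add: power2_eq_square algebra_simps)
  moreover have "c * (x\<^sup>2 / p) \<le> p / 2 * (x\<^sup>2 / p)" "c * y\<^sup>2 \<le> k / 2 * y\<^sup>2" "c * z\<^sup>2 \<le> 1 * z\<^sup>2"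
    using assms by (intro mult_right_mono; simp)+
  moreover have "p / 2 * (x\<^sup>2 / p) = x\<^sup>2 / 2" "k / 2 * y\<^sup>2 = k * y\<^sup>2 / 2"
    using \<open>p > 0\<close> by auto
  moreover have "- c * (x\<^sup>2 / p + y\<^sup>2 + z\<^sup>2) = - (c * (x\<^sup>2 / p)) - c * y\<^sup>2 - c * z\<^sup>2"
    by (simp add: algebra_simps)
  ultimately show ?thesis
    using zero_le_power2[of x] zero_le_power2[of y] by linarith
qed

theorem theorem6:
  fixes p R1 R2 R3 \<gamma>1 \<gamma>2 \<gamma>3 \<eta>1 \<eta>2 \<eta>3 :: real
  assumes "p > 0"
    and "R1 > 0" "R2 > 0" "R3 > 0"
    and "\<gamma>1 \<in> {0..1}" "\<gamma>2 \<in> {0..1}" "\<gamma>3 \<in> {0..1}"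
    and "\<eta>1 \<in> {0..1}" "\<eta>2 \<in> {0..1}" "\<eta>3 \<in> {0..1}"
  shows "\<exists>K1 K2 K3 :: real. \<forall>k1 k2 k3 :: real.
    k1 > 0 \<and> k2 > 0 \<and> k3 > 0 \<and> k1 > K1 \<and> k2 > K2 \<and> k3 > K3 \<longrightarrow>
    globally_asymptotically_stable
      (thermosyphon_field p R1 R2 R3 \<gamma>1 \<gamma>2 \<gamma>3 \<eta>1 \<eta>2 \<eta>3 k1 k2 k3) 0"
proof (intro exI allI impI)
  fix k1 k2 k3 :: real
  \<comment> \<open>Unification with this assumption fixes the witnesses \<open>K1\<close>,
    \<open>K2\<close>, \<open>K3\<close> as \<open>(1 + R1)\<^sup>2\<close>,
    \<open>(1 + R2)\<^sup>2\<close>, \<open>(1 + R3)\<^sup>2\<close>.\<close>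
  assume k: "k1 > 0 \<and> k2 > 0 \<and> k3 > 0 \<and> k1 > (1 + R1)\<^sup>2 \<and> k2 > (1 + R2)\<^sup>2 \<and> k3 > (1 + R3)\<^sup>2"
  let ?f = "thermosyphon_field p R1 R2 R3 \<gamma>1 \<gamma>2 \<gamma>3 \<eta>1 \<eta>2 \<eta>3 k1 k2 k3"
  \<comment> \<open>Half the gradient of the Lyapunov function; the weights \<open>1 / p\<close>
    cancel the factor \<open>p\<close> of the velocity equations.\<close>
  define A :: "state \<Rightarrow> state" where
    "A = (\<lambda>(x1, y1, z1, x2, y2, z2, x3, y3, z3).
      (x1 / p, y1, z1, x2 / p, y2, z2, x3 / p, y3, z3))"
  \<comment> \<open>\<open>a\<close> is the smallest coefficient of the form, and \<open>c\<close>
    the slowest of the rates allowed by the three loops.\<close>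
  define a where "a = min (1 / p) 1"
  define c where "c = Min {p / 2, k1 / 2, k2 / 2, k3 / 2, 1}"
  have "a > 0" "c > 0"
    using \<open>p > 0\<close> k by (auto simp: a_def c_def)
  have c_le: "c \<le> p / 2" "c \<le> k1 / 2" "c \<le> k2 / 2" "c \<le> k3 / 2" "c \<le> 1"
    unfolding c_def by (intro Min_le; simp)+
  show "globally_asymptotically_stable ?f 0"
  proof (rule quadratic_lyapunov_imp_globally_asymptotically_stable[OF _ _ \<open>a > 0\<close> _ \<open>c > 0\<close>])
    show "bounded_linear A"
      by (intro linear_conv_bounded_linear[THEN iffD1] linearI)
        (auto simp: A_def add_divide_distrib split: prod.splits)
    show "A u \<bullet> v = u \<bullet> A v" for u v
      by (auto simp: A_def split: prod.splits)
    show "a * (norm s)\<^sup>2 \<le> A s \<bullet> s" for s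
    proof -
      have x: "a * x\<^sup>2 \<le> x\<^sup>2 / p" and y: "a * x\<^sup>2 \<le> x\<^sup>2" for x
        using mult_right_mono[of a "1 / p" "x\<^sup>2"] mult_right_mono[of a 1 "x\<^sup>2"]
        by (simp_all add: a_def)
      obtain x1 y1 z1 x2 y2 z2 x3 y3 z3 where s: "s = (x1, y1, z1, x2, y2, z2, x3, y3, z3)"
        by (metis prod.exhaust)
      show ?thesis
        using x[of x1] x[of x2] x[of x3] y[of y1] y[of y2] y[of y3] y[of z1] y[of z2] y[of z3]
        unfolding power2_norm_eq_inner by (simp add: s A_def power2_eq_square distrib_left)
    qed
    show "A s \<bullet> ?f s \<le> - c * (A s \<bullet> s)" for s
    proof -
      obtain x1 y1 z1 x2 y2 z2 x3 y3 z3 where s: "s = (x1, y1, z1, x2, y2, z2, x3, y3, z3)"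
        by (metis prod.exhaust)
      let ?D = "\<lambda>R k x y z. (1 + R) * x * y - x\<^sup>2 - k * y\<^sup>2 - z\<^sup>2"
      let ?V = "\<lambda>x y z. x\<^sup>2 / p + y\<^sup>2 + z\<^sup>2"
      have coupling: "0 \<le> \<gamma>1 * (x1 - x2)\<^sup>2" "0 \<le> \<gamma>2 * (x1 - x3)\<^sup>2" "0 \<le> \<gamma>3 * (x2 - x3)\<^sup>2"
        "0 \<le> \<eta>1 * (z1 - z2)\<^sup>2" "0 \<le> \<eta>2 * (z1 - z3)\<^sup>2" "0 \<le> \<eta>3 * (z2 - z3)\<^sup>2"
        using assms by auto
      have cancel: "x / p * (p * w) = x * w" for x w
        using \<open>p > 0\<close> by simp
      \<comment> \<open>Each coupling coefficient enters two loops with opposite differences, and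
        its two contributions add up to minus a square. After \<open>cancel\<close> only a
        polynomial identity remains.\<close>
      have "A s \<bullet> ?f s = ?D R1 k1 x1 y1 z1 + ?D R2 k2 x2 y2 z2 + ?D R3 k3 x3 y3 z3
          - \<gamma>1 * (x1 - x2)\<^sup>2 - \<gamma>2 * (x1 - x3)\<^sup>2 - \<gamma>3 * (x2 - x3)\<^sup>2
          - \<eta>1 * (z1 - z2)\<^sup>2 - \<eta>2 * (z1 - z3)\<^sup>2 - \<eta>3 * (z2 - z3)\<^sup>2"
        unfolding s A_def thermosyphon_field_def prod.case inner_Pair inner_real_def cancel
        by (simp add: power2_eq_square algebra_simps)
      also have "\<dots> \<le> - c * ?V x1 y1 z1 + - c * ?V x2 y2 z2 + - c * ?V x3 y3 z3"
        using coupling loop_dissipation[of R1 k1 c p x1 y1 z1] loop_dissipation[of R2 k2 c p x2 y2 z2]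
          loop_dissipation[of R3 k3 c p x3 y3 z3] assms k c_le by linarith
      also have "\<dots> = - c * (A s \<bullet> s)"
        by (simp add: s A_def power2_eq_square algebra_simps)
      finally show ?thesis .
    qed
    show "\<exists>L. L-lipschitz_on (cball 0 r) ?f" for r
      by (rule thermosyphon_field_lipschitz)
    show "?f 0 = 0"
      by (simp add: thermosyphon_field_def zero_prod_def)
  qed
qed

end
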